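(* Let $\gamma>0$, $\lambda>0$, $k>1$. Let $f_0$ be the Weibull density with parameters $(\lambda,k)$, $$f_0(x)= \frac{k}{\lambda}\left(\frac{|x|}{\lambda}\right)^{k-1}\exp\left\{-\left(\frac{|x|}{\lambda}\right)^k\right\},\quad x\leq 0$$ (and $f_0=0$ for $x>0$). Define $$\phi_{2}^*(s)=\begin{cases}c_1(s+e)\exp\left\{\frac{1}{\left(2\gamma\lambda \right)^k}\log^k(s+e)\right\}+c_2s+c_3,& s\geq 0,\\ e^s-1,& s\le 0,\end{cases}$$ with $a=\frac{1}{(2\gamma\lambda)^k}$, $c_1=\frac{1}{k^2(a^2+a)e^{a-1}}$, $c_2=1-c_1e^a(ak+1)$, $c_3=-c_1e^{a+1}$. Then: (i) $\phi_2^*$ is strictly convex and twice continuously differentiable on $\mathbb{R}$, and its conjugate $\phi_2:=(\phi_2^* )^*$ belongs to $\Phi_0$. (ii) With $\phi_1^*(s)=(e^{\gamma s}-1)/\gamma$ (the entropic risk measure with parameter $\gamma$), there exist $\theta_1,\theta_2\in\mathbb{R}$ such that $\int_{\mathbb{R}} \phi_2^*\left(\phi_1^*(\theta_2-x)+\theta_1\right)f_0(x)\,\mathrm{d}x<\infty$, and there exist $\theta_1,\theta_2\in\mathbb{R}$, $\eta\ge0$ such that $\int_{\mathbb{R}} \eta\phi_2^*\left(\frac{\phi_1^*(\theta_2-x)+\theta_1}{\eta}\right)f_0(x)\,\mathrm{d}x<\infty$. (iii) For any Weibull density $g(x)=\frac{l}{\lambda}\left(\frac{|x|}{\lambda}\right)^{l-1}\exp\left\{-\left(\frac{|x|}{\lambda}\right)^l\right\}$,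 $x\le0$, with parameters $(\lambda,l)$ such that $1<l<k$, we have $I_{\phi_2}(g,f_0)<\infty$.
   Context: $\Phi_0$ is the set of all convex functions $\phi:\mathbb{R}\to[0,\infty]$ with $\phi(1)=0$ whose effective domain $\{t:\phi(t)<\infty\}$ is contained in $[0,\infty)$ and contains a neighborhood of $1$. For probability densities $g,f$ on $\mathbb{R}$, $I_\phi(g,f)=\int_{\mathbb{R}}\phi\left(\frac{g(x)}{f(x)}\right)f(x)\,\mathrm{d}x$, with the conventions $\phi(0)=\lim_{t\downarrow0}\phi(t)$, $0\phi(0/0)=0$. Conjugate: $\psi^*(t)=\sup_{s\in\mathbb{R}}\{st-\psi(s)\}$. Convention for $\eta=0$: $0\phi_2^*(s/0)=0$ if $s\le0$ and $+\infty$ if $s>0$. *)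

theory Defs
  imports "HOL-Analysis.Analysis"
begin

definition strictly_convex :: "(real \<Rightarrow> real) \<Rightarrow> bool" where
  "strictly_convex f \<longleftrightarrow>
     (\<forall>x y u. x \<noteq> y \<longrightarrow> 0 < u \<longrightarrow> u < 1 \<longrightarrow>
        f (u * x + (1 - u) * y) < u * f x + (1 - u) * f y)"

definition twice_continuously_differentiable :: "(real \<Rightarrow> real) \<Rightarrow> bool" where
  "twice_continuously_differentiable f \<longleftrightarrow>
     (\<exists>f' f''. (\<forall>x. (f has_real_derivative f' x) (at x)) \<and>
               (\<forall>x. (f' has_real_derivative f'' x) (at x)) \<and>
               continuous_on UNIV f'')"

definition ereal_convex :: "(real \<Rightarrow> ereal) \<Rightarrow> bool" where
  "ereal_convex \<phi> \<longleftrightarrow>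
     (\<forall>x y u. 0 < u \<longrightarrow> u < 1 \<longrightarrow>
        \<phi> (u * x + (1 - u) * y) \<le> ereal u * \<phi> x + ereal (1 - u) * \<phi> y)"

definition effective_domain :: "(real \<Rightarrow> ereal) \<Rightarrow> real set" where
  "effective_domain \<phi> = {t. \<phi> t < \<infinity>}"

definition Phi0 :: "(real \<Rightarrow> ereal) set" where
  "Phi0 = {\<phi>. (\<forall>t. 0 \<le> \<phi> t) \<and> ereal_convex \<phi> \<and> \<phi> 1 = 0 \<and>
                effective_domain \<phi> \<subseteq> {0..} \<and> 1 \<in> interior (effective_domain \<phi>)}"

definition conjugate :: "(real \<Rightarrow> ereal) \<Rightarrow> real \<Rightarrow> ereal" where
  "conjugate \<psi> t = (SUP s. ereal (s * t) - \<psi> s)"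

text \<open>
  Lebesgue integral with values in the extended reals, as the integral of the positive part
  minus that of the negative part (\<^const>\<open>e2ennreal\<close> maps negative numbers to 0).
  Since \<open>\<infinity> - \<infinity> = \<infinity>\<close> on \<^typ>\<open>ereal\<close>, the value is below \<open>\<infinity>\<close> only if
  the positive part has a finite integral.
\<close>
definition ext_integral :: "'a measure \<Rightarrow> ('a \<Rightarrow> ereal) \<Rightarrow> ereal" where
  "ext_integral M h =
     enn2ereal (\<integral>\<^sup>+x. e2ennreal (h x) \<partial>M) - enn2ereal (\<integral>\<^sup>+x. e2ennreal (- h x) \<partial>M)"

text \<open>
  The integrand \<open>b \<phi>(a/b)\<close> of the divergence, for \<open>a, b \<ge> 0\<close>, with the conventions
  \<open>\<phi>(0) = lim \<phi>(t)\<close> for \<open>t \<down> 0\<close> and \<open>0 \<phi>(0/0) = 0\<close>. The case \<open>b = 0 < a\<close> follows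
  Csiszar's convention \<open>0 \<phi>(a/0) = a lim \<phi>(t)/t\<close> for \<open>t \<rightarrow> \<infinity>\<close>.
\<close>
definition divergence_integrand :: "(real \<Rightarrow> ereal) \<Rightarrow> real \<Rightarrow> real \<Rightarrow> ereal" where
  "divergence_integrand \<phi> a b =
     (if b = 0 then (if a = 0 then 0 else ereal a * Lim at_top (\<lambda>t. \<phi> t / ereal t))
      else if a = 0 then Lim (at_right 0) \<phi> * ereal b
      else \<phi> (a / b) * ereal b)"

definition divergence :: "(real \<Rightarrow> ereal) \<Rightarrow> (real \<Rightarrow> real) \<Rightarrow> (real \<Rightarrow> real) \<Rightarrow> ereal" where
  "divergence \<phi> g f = ext_integral lborel (\<lambda>x. divergence_integrand \<phi> (g x) (f x))"

text \<open>\<open>\<eta> \<psi>(s/\<eta>)\<close> for \<open>\<eta> \<ge> 0\<close>, with the convention for \<open>\<eta> = 0\<close>.\<close>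
definition perspective :: "(real \<Rightarrow> real) \<Rightarrow> real \<Rightarrow> real \<Rightarrow> ereal" where
  "perspective \<psi> \<eta> s =
     (if \<eta> = 0 then (if s \<le> 0 then 0 else \<infinity>) else ereal (\<eta> * \<psi> (s / \<eta>)))"

definition weibull_density :: "real \<Rightarrow> real \<Rightarrow> real \<Rightarrow> real" where
  "weibull_density lam k x =
     (if x \<le> 0 then k / lam * (\<bar>x\<bar> / lam) powr (k - 1) * exp (- ((\<bar>x\<bar> / lam) powr k)) else 0)"

definition phi1_star :: "real \<Rightarrow> real \<Rightarrow> real" where
  "phi1_star \<gamma> s = (exp (\<gamma> * s) - 1) / \<gamma>"

definition phi2_star :: "real \<Rightarrow> real \<Rightarrow> real \<Rightarrow> real \<Rightarrow> real" where
  "phi2_star \<gamma> lam k s =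
     (let a = 1 / (2 * \<gamma> * lam) powr k;
          c1 = 1 / (k\<^sup>2 * (a\<^sup>2 + a) * exp (a - 1));
          c2 = 1 - c1 * exp a * (a * k + 1);
          c3 = - c1 * exp (a + 1)
      in if 0 \<le> s
         then c1 * (s + exp 1) *
                exp (1 / (2 * \<gamma> * lam) powr k * ln (s + exp 1) powr k) + c2 * s + c3
         else exp s - 1)"

definition phi2 :: "real \<Rightarrow> real \<Rightarrow> real \<Rightarrow> real \<Rightarrow> ereal" where
  "phi2 \<gamma> lam k = conjugate (\<lambda>s. ereal (phi2_star \<gamma> lam k s))"

end

theory Submission
  imports Defs
begin

text \<open>
  Both branches of \<open>f = \<phi>\<^sub>2\<^sup>*\<close> have value 0 and first and second derivative 1 at 0, and \<open>f'' > 0\<close>;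
  this is (i), together with \<open>f s \<ge> s\<close>, which gives \<open>\<phi>\<^sub>2 1 = 0\<close>.

  For the integrals put \<open>z = |x| / \<lambda>\<close>; every integrand is at most \<open>K exp (- z)\<close> on the negative
  half-line. In (ii), \<open>\<theta>\<^sub>1\<close> and \<open>\<theta>\<^sub>2\<close> are chosen such that the argument of \<open>f\<close> is \<open>exp (\<gamma> |x|) - e\<close>;
  then \<open>f\<close> grows like \<open>exp (\<gamma> |x| + (z / 2)\<^sup>k)\<close>, which \<open>exp (- z\<^sup>k)\<close> dominates.

  In (iii), let \<open>t\<close> be the ratio of the two densities. If the derivative of \<open>f\<close> at \<open>exp w - e\<close> is at
  least \<open>t\<close>, then \<open>\<phi>\<^sub>2 t \<le> t exp w + 1\<close>, so the integrand is at most \<open>g exp w + f\<^sub>0\<close>. For \<open>z \<ge> 1\<close> one has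
  \<open>t \<le> exp (z\<^sup>k)\<close> and \<open>w = D z\<close> suffices, while \<open>g\<close> decays like \<open>exp (- z\<^sup>l)\<close> with \<open>l > 1\<close>. For \<open>z < 1\<close>
  one has \<open>t \<le> z powr (l - k)\<close>, and since \<open>k > 1\<close> already \<open>w = C - (l - 1) ln z\<close> suffices for \<open>C\<close>
  large; the factor \<open>exp w\<close> then cancels the factor \<open>z powr (l - 1)\<close> of \<open>g\<close>.
\<close>

section \<open>Gluing two differentiable functions at 0\<close>

lemma has_real_derivative_If_at_0:
  fixes g h :: "real \<Rightarrow> real"
  assumes "(g has_real_derivative D) (at 0)" "(h has_real_derivative D) (at 0)" "g 0 = h 0"
  shows "((\<lambda>x. if 0 \<le> x then g x else h x) has_real_derivative D) (at 0)"
proof -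
  let ?f = "\<lambda>x. if 0 \<le> x then g x else h x"
  have "((\<lambda>y. (g y - g 0) / (y - 0)) \<longlongrightarrow> D) (at_right 0)"
    "((\<lambda>y. (h y - h 0) / (y - 0)) \<longlongrightarrow> D) (at_left 0)"
    using assms(1,2) by (simp_all add: has_field_derivative_iff filterlim_at_split)
  moreover have "\<forall>\<^sub>F y in at_right 0. (g y - g 0) / (y - 0) = (?f y - ?f 0) / (y - 0)"
    by (auto simp: eventually_at_filter)
  \<comment> \<open>The glued function takes the value \<open>g 0\<close> at 0, so on the left the
    quotients agree only because of \<open>g 0 = h 0\<close>.\<close>
  moreover have "\<forall>\<^sub>F y in at_left 0. (h y - h 0) / (y - 0) = (?f y - ?f 0) / (y - 0)"
    using assms(3) by (auto simp: eventually_at_filter)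
  ultimately have "((\<lambda>y. (?f y - ?f 0) / (y - 0)) \<longlongrightarrow> D) (at_right 0)"
    "((\<lambda>y. (?f y - ?f 0) / (y - 0)) \<longlongrightarrow> D) (at_left 0)"
    by (blast intro: Lim_transform_eventually)+
  then show ?thesis
    unfolding has_field_derivative_iff filterlim_at_split by blast
qed

text \<open>Serves twice, for \<open>phi2_star\<close> and for its derivative. Each branch is asked
  to be differentiable only on its own closed half-line, since the right one involves
  \<open>ln (s + exp 1)\<close>.\<close>

lemma has_real_derivative_If_0_le:
  fixes g h :: "real \<Rightarrow> real"
  assumes g: "\<And>x. 0 \<le> x \<Longrightarrow> (g has_real_derivative g' x) (at x)"
    and h: "\<And>x. x \<le> 0 \<Longrightarrow> (h has_real_derivative h' x) (at x)"
    and eq: "g 0 = h 0" "g' 0 = h' 0"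
  shows "((\<lambda>x. if 0 \<le> x then g x else h x) has_real_derivative (if 0 \<le> x then g' x else h' x)) (at x)"
proof (cases x "0::real" rule: linorder_cases)
  case less
  have "\<forall>\<^sub>F y in nhds x. y \<in> {..<0}"
    by (rule eventually_nhds_in_open) (use less in auto)
  then have "\<forall>\<^sub>F y in nhds x. (if 0 \<le> y then g y else h y) = h y"
    by (rule eventually_mono) auto
  then show ?thesis
    using h[of x] less by (subst DERIV_cong_ev[OF refl _ refl]) auto
next
  case equal
  show ?thesis
    using has_real_derivative_If_at_0[of g "g' 0" h] g[of 0] h[of 0] eq equal by simp
next
  case greater
  have "\<forall>\<^sub>F y in nhds x. y \<in> {0<..}"
    by (rule eventually_nhds_in_open) (use greater in auto)
  then have "\<forall>\<^sub>F y in nhds x. (if 0 \<le> y then g y else h y) = g y"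
    by (rule eventually_mono) auto
  then show ?thesis
    using g[of x] greater by (subst DERIV_cong_ev[OF refl _ refl]) auto
qed

section \<open>Convexity from increasing derivatives and from conjugation\<close>

lemma above_tangent_strict:
  fixes f :: "real \<Rightarrow> real"
  assumes f: "\<And>x. (f has_real_derivative f' x) (at x)" and mono: "strict_mono f'" and "x \<noteq> y"
  shows "f x + f' x * (y - x) < f y"
proof (cases "x < y")
  case True
  obtain z where z: "x < z" "z < y" "f y - f x = (y - x) * f' z"
    using MVT2[OF True, of f f'] f by blast
  then have "f' x * (y - x) < f' z * (y - x)"
    using mono True by (intro mult_strict_right_mono) (auto simp: strict_mono_def)
  then show ?thesis using z(3) by (simp add: algebra_simps)
next
  case False
  then have "y < x" using \<open>x \<noteq> y\<close> by simp
  then obtain z where z: "y < z" "z < x" "f x - f y = (x - y) * f' z"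
    using MVT2[of y x f f'] f by blast
  then have "f' z * (x - y) < f' x * (x - y)"
    using mono \<open>y < x\<close> by (intro mult_strict_right_mono) (auto simp: strict_mono_def)
  then show ?thesis using z(3) by (simp add: algebra_simps)
qed

text \<open>Average the strict tangent inequalities at the intermediate point \<open>z\<close> with
  weights \<open>u\<close> and \<open>1 - u\<close>: the slope terms cancel, as \<open>z\<close> is
  the weighted mean.\<close>

lemma strictly_convex_if_derivative_strict_mono:
  fixes f :: "real \<Rightarrow> real"
  assumes f: "\<And>x. (f has_real_derivative f' x) (at x)" and mono: "strict_mono f'"
  shows "strictly_convex f"
  unfolding strictly_convex_def
proof (intro allI impI)
  fix x y u :: real
  assume "x \<noteq> y" "0 < u" "u < 1"
  define z where "z = u * x + (1 - u) * y"
  have *: "z - x = (1 - u) * (y - x)" "z - y = u * (x - y)"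
    by (simp_all add: z_def algebra_simps)
  then have "z \<noteq> x" "z \<noteq> y" using \<open>x \<noteq> y\<close> \<open>0 < u\<close> \<open>u < 1\<close> by auto
  then have "u * (f z + f' z * (x - z)) + (1 - u) * (f z + f' z * (y - z)) < u * f x + (1 - u) * f y"
    using above_tangent_strict[OF f mono] \<open>0 < u\<close> \<open>u < 1\<close>
    by (intro add_strict_mono mult_strict_left_mono) auto
  moreover have "u * (f z + f' z * (x - z)) + (1 - u) * (f z + f' z * (y - z))
      = f z + f' z * (u * x + (1 - u) * y - z)"
    by (simp add: algebra_simps)
  ultimately show "f (u * x + (1 - u) * y) < u * f x + (1 - u) * f y"
    unfolding z_def by simp
qed

text \<open>A supremum of affine functions of the argument is convex; with \<psi> real-valued, each
  of these functions is finite.\<close>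

lemma ereal_convex_conjugate:
  "ereal_convex (conjugate (\<lambda>s. ereal (\<psi> s)))"
  unfolding ereal_convex_def
proof (intro allI impI)
  fix x y u :: real
  assume u: "0 < u" "u < 1"
  let ?c = "conjugate (\<lambda>s. ereal (\<psi> s))"
  have ub: "ereal (s * t - \<psi> s) \<le> ?c t" for s t
    unfolding conjugate_def by (rule SUP_upper2[of s]) auto
  show "?c (u * x + (1 - u) * y) \<le> ereal u * ?c x + ereal (1 - u) * ?c y"
    unfolding conjugate_def[of _ "u * x + (1 - u) * y"]
  proof (rule SUP_least)
    fix s :: real
    have "ereal (s * (u * x + (1 - u) * y)) - ereal (\<psi> s)
        = ereal u * ereal (s * x - \<psi> s) + ereal (1 - u) * ereal (s * y - \<psi> s)"
      by (simp add: algebra_simps)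
    also have "\<dots> \<le> ereal u * ?c x + ereal (1 - u) * ?c y"
      using u by (intro add_mono ereal_mult_left_mono ub) auto
    finally show "ereal (s * (u * x + (1 - u) * y)) - ereal (\<psi> s)
        \<le> ereal u * ?c x + ereal (1 - u) * ?c y" .
  qed
qed

section \<open>Exponential bounds and finite integrals\<close>

lemma powr_times_exp_bounded_by_exp_minus:
  fixes p c d q :: real
  assumes "0 \<le> p" "0 < c" "1 < q"
  obtains K where "0 \<le> K" "\<And>z. 0 \<le> z \<Longrightarrow> z powr p * exp (d * z - c * z powr q) \<le> K * exp (- z)"
proof
  \<comment> \<open>\<open>B\<close> collects the rates of
    \<open>z powr p \<le> exp (p * z)\<close>, of \<open>exp (d * z)\<close> and of the desired
    \<open>exp (- z)\<close>. \<open>R\<close> solves \<open>c * R powr (q - 1) = B\<close>: beyond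
    it \<open>c * z powr q\<close> exceeds \<open>B * z\<close>, before it \<open>B * z\<close> is
    at most \<open>B * R\<close>.\<close>
  define B where "B = p + \<bar>d\<bar> + 1"
  define R where "R = (B / c) powr (1 / (q - 1))"
  show "0 \<le> exp (B * R)" by simp
  fix z :: real assume z: "0 \<le> z"
  have B: "0 < B" using assms by (simp add: B_def)
  have exponent: "B * z - c * z powr q \<le> B * R"
  proof (cases "z \<le> R")
    case True
    then have "B * z \<le> B * R" using B by simp
    moreover have "0 \<le> c * z powr q" using assms by simp
    ultimately show ?thesis by linarith
  next
    case False
    have "0 < R" using B assms by (simp add: R_def)
    with False have "0 < z" by simp
    have "B / c = R powr (q - 1)" using assms B by (simp add: R_def powr_powr)
    also have "\<dots> \<le> z powr (q - 1)"
      using False \<open>0 < R\<close> assms by (intro powr_mono2) auto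
    finally have "B \<le> c * z powr (q - 1)" using assms by (simp add: field_simps)
    then have "B * z \<le> c * z powr (q - 1) * z" using z by (rule mult_right_mono)
    also have "\<dots> = c * z powr q" using \<open>0 < z\<close> by (simp add: powr_diff)
    finally show ?thesis using \<open>0 < R\<close> B by (smt (verit) mult_pos_pos)
  qed
  have "z powr p \<le> exp (p * z)"
  proof (cases "z = 0")
    case False
    then have "z powr p = exp (p * ln z)" by (simp add: powr_def)
    moreover have "ln z \<le> z" using False z ln_le_minus_one[of z] by linarith
    ultimately show ?thesis using assms(1) by (simp add: mult_left_mono)
  qed simp
  then have "z powr p * exp (d * z - c * z powr q) \<le> exp (p * z) * exp (d * z - c * z powr q)"
    by (rule mult_right_mono) simp
  also have "\<dots> = exp ((p + d) * z - c * z powr q)"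
    by (simp add: exp_add[symmetric] algebra_simps)
  also have "\<dots> \<le> exp (B * R - z)"
  proof -
    have "(p + d) * z \<le> (B - 1) * z" using z by (intro mult_right_mono) (auto simp: B_def)
    then show ?thesis using exponent by (simp add: algebra_simps)
  qed
  also have "\<dots> = exp (B * R) * exp (- z)" by (simp add: exp_add[symmetric])
  finally show "z powr p * exp (d * z - c * z powr q) \<le> exp (B * R) * exp (- z)" .
qed

text \<open>Only the positive part needs a bound: once its integral is finite, subtracting that of
  the negative part cannot give infinity.\<close>

lemma ext_integral_less_infinity_if_exp_bound:
  fixes h :: "real \<Rightarrow> ereal"
  assumes "0 < lam" "0 \<le> K"
    and neg: "\<And>x. x < 0 \<Longrightarrow> h x \<le> ereal (K * exp (- (\<bar>x\<bar> / lam)))"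
    and nonneg: "\<And>x. 0 \<le> x \<Longrightarrow> h x \<le> 0"
  shows "ext_integral lborel h < \<infinity>"
proof -
  let ?g = "\<lambda>x. ennreal (K * exp (x / lam)) * indicator {..0} x"
  have "e2ennreal (h x) \<le> ?g x" for x
  proof (cases "x < 0")
    case True
    then have "e2ennreal (h x) \<le> e2ennreal (ereal (K * exp (x / lam)))"
      using neg[of x] by (intro e2ennreal_mono) auto
    then show ?thesis using True by simp
  next
    case False
    then show ?thesis using nonneg[of x] by (simp add: e2ennreal_neg)
  qed
  then have "(\<integral>\<^sup>+x. e2ennreal (h x) \<partial>lborel) \<le> (\<integral>\<^sup>+x. ?g x \<partial>lborel)"
    by (intro nn_integral_mono) auto
  \<comment> \<open>Reflection moves the integral to \<open>{0..}\<close>, where an antiderivative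
    vanishing at infinity evaluates it.\<close>
  also have "\<dots> = (\<integral>\<^sup>+x. ?g (0 + (- 1) * x) \<partial>lborel)"
    by (subst nn_integral_real_affine[where c = "- 1" and t = 0]) auto
  also have "\<dots> = (\<integral>\<^sup>+x. ennreal (K * exp (- x / lam)) * indicator {0..} x \<partial>lborel)"
    by (intro nn_integral_cong) (auto simp: indicator_def)
  also have "\<dots> = ennreal (0 - (- K * lam * exp (- 0 / lam)))"
  proof (rule nn_integral_FTC_atLeast)
    show "((\<lambda>x. - K * lam * exp (- x / lam)) has_real_derivative K * exp (- x / lam)) (at x)" for x
      using assms(1) by (auto intro!: derivative_eq_intros)
    have "filterlim (\<lambda>x. - x / lam) at_bot at_top"
      using assms(1) filterlim_tendsto_neg_mult_at_bot[OF tendsto_const, of "- (1 / lam)" "\<lambda>x::real. x" at_top]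
      by (simp add: filterlim_ident)
    then have "((\<lambda>x. exp (- x / lam)) \<longlongrightarrow> 0) at_top"
      by (rule filterlim_compose[OF exp_at_bot])
    from tendsto_mult_right_zero[OF this, of "- K * lam"]
    show "((\<lambda>x. - K * lam * exp (- x / lam)) \<longlongrightarrow> 0) at_top" .
  qed (use assms in auto)
  finally have "(\<integral>\<^sup>+x. e2ennreal (h x) \<partial>lborel) < \<infinity>"
    by (rule le_less_trans) auto
  then have "enn2ereal (\<integral>\<^sup>+x. e2ennreal (h x) \<partial>lborel) < \<infinity>"
    by (metis enn2ereal_eq_top_iff infinity_ennreal_def ereal_less_PInfty less_irrefl top_ereal_def)
  then show ?thesis
    unfolding ext_integral_def
    using enn2ereal_nonneg[of "\<integral>\<^sup>+x. e2ennreal (- h x) \<partial>lborel"]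
    by (cases "enn2ereal (\<integral>\<^sup>+x. e2ennreal (h x) \<partial>lborel)";
        cases "enn2ereal (\<integral>\<^sup>+x. e2ennreal (- h x) \<partial>lborel)") auto
qed

section \<open>The nonlinear part of the right branch, in the variable
  \<open>u = s + exp 1\<close>\<close>

definition log_weibull :: "real \<Rightarrow> real \<Rightarrow> real \<Rightarrow> real" where
  "log_weibull a k u = u * exp (a * ln u powr k)"

definition log_weibull' :: "real \<Rightarrow> real \<Rightarrow> real \<Rightarrow> real" where
  "log_weibull' a k u = exp (a * ln u powr k) * (1 + a * k * ln u powr (k - 1))"

definition log_weibull'' :: "real \<Rightarrow> real \<Rightarrow> real \<Rightarrow> real" where
  "log_weibull'' a k u = exp (a * ln u powr k) / u *
     (a * k * ln u powr (k - 1) * (1 + a * k * ln u powr (k - 1))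
      + a * k * (k - 1) * ln u powr (k - 2))"

text \<open>The condition \<open>1 < u\<close> keeps the base \<open>ln u\<close> of the power
  positive; on the right branch \<open>u \<ge> exp 1\<close>.\<close>

lemma has_real_derivative_ln_powr:
  assumes "1 < u"
  shows "((\<lambda>u. ln u powr p) has_real_derivative p * ln u powr (p - 1) / u) (at u)"
proof -
  have "((\<lambda>z. z powr p) has_real_derivative p * ln u powr (p - 1)) (at (ln u))"
    using assms by (intro has_real_derivative_powr) simp
  moreover have "(ln has_real_derivative 1 / u) (at u)"
    using assms by (intro DERIV_ln_divide) simp
  ultimately show ?thesis
    by (auto dest: DERIV_chain2)
qed

lemma has_real_derivative_log_weibull:
  assumes "1 < u"
  shows "(log_weibull a k has_real_derivative log_weibull' a k u) (at u)"
proof -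
  have "((\<lambda>u. u * exp (a * ln u powr k)) has_real_derivative log_weibull' a k u) (at u)"
    using assms
    by (auto intro!: derivative_eq_intros has_real_derivative_ln_powr
        simp: log_weibull'_def field_simps)
  then show ?thesis by (simp add: log_weibull_def[abs_def])
qed

lemma has_real_derivative_log_weibull':
  assumes "1 < u"
  shows "(log_weibull' a k has_real_derivative log_weibull'' a k u) (at u)"
proof -
  have "((\<lambda>u. exp (a * ln u powr k) * (1 + a * k * ln u powr (k - 1))) has_real_derivative
      log_weibull'' a k u) (at u)"
    using assms
    by (auto intro!: derivative_eq_intros has_real_derivative_ln_powr
        simp: log_weibull''_def field_simps)
  then show ?thesis by (simp add: log_weibull'_def[abs_def])
qed

lemma log_weibull''_pos:
  assumes "1 < u" "0 < a" "1 < k"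
  shows "0 < log_weibull'' a k u"
  unfolding log_weibull''_def using assms
  by (intro mult_pos_pos divide_pos_pos add_pos_pos) auto

text \<open>The point \<open>s = 0\<close> is \<open>u = exp 1\<close>, where all powers of
  \<open>ln u\<close> are 1; the value is the reciprocal of \<open>c1\<close>.\<close>

lemma log_weibull''_exp_1:
  "log_weibull'' a k (exp 1) = k\<^sup>2 * (a\<^sup>2 + a) * exp (a - 1)"
  by (simp add: log_weibull''_def exp_diff power2_eq_square field_simps)

section \<open>Smoothness and strict convexity of \<open>phi2_star\<close>\<close>

locale weibull_entropic =
  fixes \<gamma> lam k :: real
  assumes gamma_pos: "0 < \<gamma>" and lam_pos: "0 < lam" and k_gt_1: "1 < k"
begin

definition a where "a = 1 / (2 * \<gamma> * lam) powr k"
text \<open>The constants match the right branch to \<open>exp s - 1\<close> at 0: \<open>c1\<close>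
  normalizes the second derivative, \<open>c2\<close> the first derivative and \<open>c3\<close> the
  value.\<close>

definition c1 where "c1 = 1 / (k\<^sup>2 * (a\<^sup>2 + a) * exp (a - 1))"
definition c2 where "c2 = 1 - c1 * exp a * (a * k + 1)"
definition c3 where "c3 = - c1 * exp (a + 1)"

abbreviation f where "f \<equiv> phi2_star \<gamma> lam k"

definition f' where
  "f' s = (if 0 \<le> s then c1 * log_weibull' a k (s + exp 1) + c2 else exp s)"

definition f'' where
  "f'' s = (if 0 \<le> s then c1 * log_weibull'' a k (s + exp 1) else exp s)"

lemma a_pos: "0 < a"
  using gamma_pos lam_pos by (simp add: a_def)

lemma c1_pos: "0 < c1"
  using a_pos k_gt_1 by (simp add: c1_def add_pos_pos)

lemma f_eq:
  "f = (\<lambda>s. if 0 \<le> s then c1 * log_weibull a k (s + exp 1) + c2 * s + c3 else exp s - 1)"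
  by (simp add: fun_eq_iff phi2_star_def a_def c1_def c2_def c3_def Let_def log_weibull_def)

lemma exp_1_plus_gt_1: "0 \<le> s \<Longrightarrow> 1 < s + exp (1::real)"
  using exp_gt_one[of "1::real"] by linarith

lemma f_0: "f 0 = 0"
  by (simp add: f_eq log_weibull_def c3_def exp_add)

lemma f'_0: "f' 0 = 1"
  by (simp add: f'_def log_weibull'_def c2_def algebra_simps)

lemma f''_0: "f'' 0 = 1"
  using a_pos k_gt_1 add_pos_pos[of "a\<^sup>2" a] by (simp add: f''_def log_weibull''_exp_1 c1_def)

lemma f_has_derivative: "(f has_real_derivative f' s) (at s)"
  unfolding f_eq f'_def
proof (rule has_real_derivative_If_0_le)
  fix s :: real assume "0 \<le> s"
  then have "(log_weibull a k has_real_derivative log_weibull' a k (s + exp 1)) (at (s + exp 1))"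
    by (intro has_real_derivative_log_weibull exp_1_plus_gt_1)
  then have "((\<lambda>s. log_weibull a k (s + exp 1)) has_real_derivative
      log_weibull' a k (s + exp 1)) (at s)"
    by (simp add: DERIV_shift)
  then show "((\<lambda>s. c1 * log_weibull a k (s + exp 1) + c2 * s + c3) has_real_derivative
      c1 * log_weibull' a k (s + exp 1) + c2) (at s)"
    by (auto intro!: derivative_eq_intros)
qed (use f_0 f'_0 in \<open>auto intro!: derivative_eq_intros simp: f_eq f'_def\<close>)

lemma f'_has_derivative: "(f' has_real_derivative f'' s) (at s)"
proof -
  have "((\<lambda>s. if 0 \<le> s then c1 * log_weibull' a k (s + exp 1) + c2 else exp s)
      has_real_derivative f'' s) (at s)"
    unfolding f''_def
  proof (rule has_real_derivative_If_0_le)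
    fix s :: real assume "0 \<le> s"
    then have "(log_weibull' a k has_real_derivative log_weibull'' a k (s + exp 1)) (at (s + exp 1))"
      by (intro has_real_derivative_log_weibull' exp_1_plus_gt_1)
    then have "((\<lambda>s. log_weibull' a k (s + exp 1)) has_real_derivative
        log_weibull'' a k (s + exp 1)) (at s)"
      by (simp add: DERIV_shift)
    then show "((\<lambda>s. c1 * log_weibull' a k (s + exp 1) + c2) has_real_derivative
        c1 * log_weibull'' a k (s + exp 1)) (at s)"
      by (auto intro!: derivative_eq_intros)
  qed (use f'_0 f''_0 in \<open>auto intro!: derivative_eq_intros simp: f'_def f''_def\<close>)
  then show ?thesis by (simp add: f'_def[abs_def])
qed

lemma continuous_f'': "continuous_on UNIV f''"
proof -
  \<comment> \<open>These are the denominator and the base of the powers in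
    \<open>log_weibull''\<close>; the exponent \<open>k - 2\<close> may be negative.\<close>
  have nz: "s + exp 1 \<noteq> 0" "ln (s + exp 1) \<noteq> 0" if "0 \<le> s" for s :: real
    using exp_1_plus_gt_1[OF that] by auto
  have "continuous_on ({0..} \<union> {..0})
      (\<lambda>s. if 0 \<le> s then c1 * log_weibull'' a k (s + exp 1) else exp s)"
  proof (rule continuous_on_If)
    show "continuous_on {0..} (\<lambda>s. c1 * log_weibull'' a k (s + exp 1))"
      unfolding log_weibull''_def
      by (intro continuous_intros ballI) (simp_all add: nz)
  qed (use f''_0 in \<open>auto intro!: continuous_intros simp: f''_def not_le\<close>)
  moreover have "{0..} \<union> {..0} = (UNIV :: real set)" by auto
  ultimately show ?thesis by (simp add: f''_def[abs_def])
qed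

lemma f''_pos: "0 < f'' s"
  using c1_pos a_pos k_gt_1 exp_1_plus_gt_1 by (simp add: f''_def log_weibull''_pos)

lemma f'_strict_mono: "strict_mono f'"
  unfolding strict_mono_def using f'_has_derivative f''_pos DERIV_pos_imp_increasing by metis

lemma f_above_tangent: "f s + f' s * (t - s) \<le> f t"
  using above_tangent_strict[OF f_has_derivative f'_strict_mono, of s t] by (cases "s = t") auto

lemma f_strictly_convex: "strictly_convex f"
  using strictly_convex_if_derivative_strict_mono[OF f_has_derivative f'_strict_mono] .

lemma f_twice_continuously_differentiable: "twice_continuously_differentiable f"
  unfolding twice_continuously_differentiable_def
  using f_has_derivative f'_has_derivative continuous_f'' by blast

text \<open>The identity is the tangent at 0. This gives \<open>phi2\<close> the value 0 at 1, and
  makes \<open>f\<close> nonnegative on the right branch.\<close>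

lemma f_ge_self: "s \<le> f s"
  using f_above_tangent[of 0 s] by (simp add: f_0 f'_0)

section \<open>Bounds for the conjugate \<open>phi2\<close>\<close>

lemma phi2_upper: "ereal (s * t - f s) \<le> phi2 \<gamma> lam k t"
  unfolding phi2_def conjugate_def by (rule SUP_upper2[of s]) auto

lemma phi2_least:
  assumes "\<And>s. s * t - f s \<le> B"
  shows "phi2 \<gamma> lam k t \<le> ereal B"
  unfolding phi2_def conjugate_def using assms by (intro SUP_least) simp

lemma phi2_nonneg: "0 \<le> phi2 \<gamma> lam k t"
  using phi2_upper[of 0 t] by (simp add: f_0 zero_ereal_def)

text \<open>By \<open>le\<close>, \<open>t\<close> is at most the slope of \<open>f\<close> at
  \<open>S\<close>, so \<open>s * t - f s\<close> does not rise above its value at \<open>S\<close>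
  for larger \<open>s\<close>. On \<open>{0..S}\<close> it is at most \<open>t * S\<close>. The
  summand 1 pays for negative \<open>s\<close>, where \<open>- f s = 1 - exp s\<close>.\<close>

lemma phi2_le:
  assumes t: "0 \<le> t" and w: "1 \<le> w" and le: "t \<le> c1 * exp (a * w powr k) + c2"
  shows "phi2 \<gamma> lam k t \<le> ereal (t * exp w + 1)"
proof (rule phi2_least)
  fix s :: real
  \<comment> \<open>At this point \<open>ln (S + exp 1) = w\<close>, and \<open>1 \<le> w\<close>
    places it on the right branch.\<close>
  define S where "S = exp w - exp 1"
  have S: "0 \<le> S" "S + exp 1 = exp w" using w by (simp_all add: S_def)
  have tS: "t * S \<le> t * exp w" using t by (intro mult_left_mono) (auto simp: S_def)
  consider "s < 0" | "0 \<le> s" "s \<le> S" | "S < s" by linarith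
  then show "s * t - f s \<le> t * exp w + 1"
  proof cases
    case 1
    then have "s * t \<le> 0" "f s = exp s - 1" "0 \<le> t * exp w"
      using t by (auto simp: f_eq mult_nonpos_nonneg)
    then show ?thesis using exp_gt_zero[of s] by linarith
  next
    case 2
    then have "s * t \<le> S * t" "0 \<le> f s"
      using t f_ge_self[of s] by (auto intro: mult_right_mono)
    then show ?thesis using tS by (simp add: mult.commute)
  next
    case 3
    have "c1 * exp (a * w powr k) * 1 \<le> c1 * exp (a * w powr k) * (1 + a * k * w powr (k - 1))"
      using c1_pos a_pos k_gt_1 by (intro mult_left_mono) auto
    then have "t \<le> f' S"
      using le S by (simp add: f'_def log_weibull'_def algebra_simps)
    then have "t * (s - S) \<le> f' S * (s - S)" using 3 by (intro mult_right_mono) auto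
    moreover have "0 \<le> f S" using S f_ge_self[of S] by linarith
    ultimately show ?thesis
      using f_above_tangent[of S s] tS by (simp add: algebra_simps)
  qed
qed

lemma phi2_less_infinity:
  assumes "0 \<le> t"
  shows "phi2 \<gamma> lam k t < \<infinity>"
proof -
  \<comment> \<open>Chosen such that \<open>c1 * a * X\<close> is
    \<open>\<bar>t\<bar> + \<bar>c2\<bar>\<close>; then \<open>w = 1 + X\<close> satisfies the
    hypothesis of \<open>phi2_le\<close>.\<close>
  define X where "X = (\<bar>t\<bar> + \<bar>c2\<bar>) / (c1 * a)"
  have "0 \<le> X" using c1_pos a_pos by (simp add: X_def)
  then have "1 + X \<le> (1 + X) powr k" using k_gt_1 powr_mono[of 1 k "1 + X"] by simp
  then have "a * X \<le> a * (1 + X) powr k" using a_pos by (intro mult_left_mono) auto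
  also have "\<dots> \<le> exp (a * (1 + X) powr k)"
    using exp_ge_add_one_self[of "a * (1 + X) powr k"] by linarith
  finally have "c1 * (a * X) \<le> c1 * exp (a * (1 + X) powr k)"
    using c1_pos by (intro mult_left_mono) auto
  moreover have "c1 * (a * X) = \<bar>t\<bar> + \<bar>c2\<bar>" using c1_pos a_pos by (simp add: X_def)
  ultimately have "t \<le> c1 * exp (a * (1 + X) powr k) + c2" by linarith
  from phi2_le[OF assms _ this] \<open>0 \<le> X\<close>
  have "phi2 \<gamma> lam k t \<le> ereal (t * exp (1 + X) + 1)" by simp
  then show ?thesis by (rule le_less_trans) simp
qed

text \<open>On the left branch \<open>f\<close> stays below 0, while \<open>s * t\<close> grows
  without bound as \<open>s\<close> decreases.\<close>

lemma phi2_negative: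
  assumes "t < 0"
  shows "phi2 \<gamma> lam k t = \<infinity>"
proof -
  have "ereal B \<le> phi2 \<gamma> lam k t" for B
  proof -
    define s where "s = (\<bar>B\<bar> + 1) / t"
    have "s < 0" using assms by (simp add: s_def divide_pos_neg)
    then have "f s \<le> 0" by (simp add: f_eq)
    moreover have "s * t = \<bar>B\<bar> + 1" using assms by (simp add: s_def)
    ultimately have "B \<le> s * t - f s" by linarith
    then show ?thesis using phi2_upper[of s t] by (meson ereal_less_eq(3) order_trans)
  qed
  then show ?thesis by (simp add: ereal_top)
qed

lemma phi2_in_Phi0: "phi2 \<gamma> lam k \<in> Phi0"
proof -
  have "phi2 \<gamma> lam k 1 \<le> 0"
    using phi2_least[of 1 0] f_ge_self by (simp add: zero_ereal_def)
  then have "phi2 \<gamma> lam k 1 = 0" using phi2_nonneg[of 1] by (rule antisym)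
  moreover have domain: "effective_domain (phi2 \<gamma> lam k) = {0..}"
  proof (intro set_eqI)
    show "t \<in> effective_domain (phi2 \<gamma> lam k) \<longleftrightarrow> t \<in> {0..}" for t
      using phi2_less_infinity[of t] phi2_negative[of t]
      by (cases "0 \<le> t") (simp_all add: effective_domain_def)
  qed
  moreover have "1 \<in> interior {0::real..}" by simp
  moreover have "ereal_convex (phi2 \<gamma> lam k)"
    unfolding phi2_def by (rule ereal_convex_conjugate)
  ultimately show ?thesis using phi2_nonneg by (simp add: Phi0_def)
qed

section \<open>Finiteness of the integral of \<open>phi2_star\<close> against the Weibull
  density\<close>

lemma phi2_star_integral_finite:
  "ext_integral lborel
     (\<lambda>x. ereal (f (phi1_star \<gamma> (ln \<gamma> / \<gamma> - x) + (1 / \<gamma> - exp 1)))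
           * ereal (weibull_density lam k x)) < \<infinity>"
proof -
  obtain K where K: "0 \<le> K" "\<And>z. 0 \<le> z \<Longrightarrow>
      z powr (k - 1) * exp (\<gamma> * lam * z - 1 / 2 * z powr k) \<le> K * exp (- z)"
    using powr_times_exp_bounded_by_exp_minus[of "k - 1" "1 / 2" k "\<gamma> * lam"] k_gt_1 by auto
  define C where "C = c1 + \<bar>c2\<bar>"
  have C: "0 \<le> C" using c1_pos by (simp add: C_def)
  \<comment> \<open>The shift \<open>ln \<gamma> / \<gamma>\<close> cancels the factor
    \<open>1 / \<gamma>\<close> of \<open>phi1_star\<close>, and \<open>1 / \<gamma>\<close> its
    constant; \<open>- exp 1\<close> offsets the shift inside \<open>log_weibull\<close>.\<close>
  have arg: "phi1_star \<gamma> (ln \<gamma> / \<gamma> - x) + (1 / \<gamma> - exp 1) = exp (- \<gamma> * x) - exp 1" for x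
  proof -
    have "\<gamma> * (ln \<gamma> / \<gamma> - x) = ln \<gamma> + - \<gamma> * x" using gamma_pos by (simp add: field_simps)
    then have "exp (\<gamma> * (ln \<gamma> / \<gamma> - x)) = \<gamma> * exp (- \<gamma> * x)"
      using gamma_pos by (simp only: exp_add exp_ln)
    then show ?thesis using gamma_pos by (simp add: phi1_star_def field_simps)
  qed
  have bound: "f (exp (- \<gamma> * x) - exp 1) * weibull_density lam k x
      \<le> C * (k / lam) * K * exp (- (\<bar>x\<bar> / lam))" if "x < 0" for x
  proof -
    define z where "z = \<bar>x\<bar> / lam"
    have z: "0 < z" "- \<gamma> * x = \<gamma> * lam * z" using lam_pos that by (auto simp: z_def divide_neg_pos)
    define s where "s = exp (\<gamma> * lam * z) - exp 1"
    have "f s \<le> C * exp (\<gamma> * lam * z + 1 / 2 * z powr k)"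
    proof (cases "0 \<le> s")
      case False
      then have "f s \<le> 0" by (simp add: f_eq)
      also have "0 \<le> C * exp (\<gamma> * lam * z + 1 / 2 * z powr k)" using C by simp
      finally show ?thesis .
    next
      case True
      \<comment> \<open>The definition of \<open>a\<close> turns this power into
        \<open>(z / 2) powr k\<close>, and \<open>k > 1\<close> bounds it by half of
        \<open>z powr k\<close>, leaving the other half of the density's exponent for decay.\<close>
      have "a * (\<gamma> * lam * z) powr k = (z / 2) powr k"
        using gamma_pos lam_pos z by (simp add: a_def powr_mult powr_divide)
      also have "\<dots> = (1 / 2) powr k * z powr k"
        using z by (simp add: powr_divide)
      also have "\<dots> \<le> 1 / 2 * z powr k"
        using k_gt_1 powr_mono'[of 1 k "1 / 2"] by (intro mult_right_mono) auto
      finally have le: "a * (\<gamma> * lam * z) powr k \<le> 1 / 2 * z powr k" .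
      have "c1 * log_weibull a k (s + exp 1) = c1 * exp (\<gamma> * lam * z + a * (\<gamma> * lam * z) powr k)"
        by (simp add: s_def log_weibull_def exp_add)
      also have "\<dots> \<le> c1 * exp (\<gamma> * lam * z + 1 / 2 * z powr k)"
        using le c1_pos by simp
      finally have 1: "c1 * log_weibull a k (s + exp 1) \<le> c1 * exp (\<gamma> * lam * z + 1 / 2 * z powr k)" .
      have "c2 * s \<le> \<bar>c2\<bar> * s" using True by (intro mult_right_mono) auto
      also have "s \<le> exp (\<gamma> * lam * z + 1 / 2 * z powr k)"
      proof -
        have "s \<le> exp (\<gamma> * lam * z)" by (simp add: s_def)
        also have "\<dots> \<le> exp (\<gamma> * lam * z + 1 / 2 * z powr k)" by simp
        finally show ?thesis .
      qed
      finally have 2: "c2 * s \<le> \<bar>c2\<bar> * exp (\<gamma> * lam * z + 1 / 2 * z powr k)"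
        by (simp add: mult_left_mono)
      have "c3 \<le> 0" using c1_pos by (simp add: c3_def)
      then show ?thesis using 1 2 True by (simp add: f_eq C_def distrib_right)
    qed
    moreover have w: "weibull_density lam k x = k / lam * z powr (k - 1) * exp (- (z powr k))"
      using that by (simp add: weibull_density_def z_def)
    ultimately have "f s * weibull_density lam k x
        \<le> C * exp (\<gamma> * lam * z + 1 / 2 * z powr k) * (k / lam * z powr (k - 1) * exp (- (z powr k)))"
      using lam_pos k_gt_1 by (simp only: w) (intro mult_right_mono, auto)
    also have "\<dots> = C * (k / lam) * (z powr (k - 1) *
        (exp (\<gamma> * lam * z + 1 / 2 * z powr k) * exp (- (z powr k))))"
      by (simp only: mult_ac)
    also have "exp (\<gamma> * lam * z + 1 / 2 * z powr k) * exp (- (z powr k))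
        = exp (\<gamma> * lam * z - 1 / 2 * z powr k)"
      by (simp add: exp_add[symmetric])
    also have "C * (k / lam) * (z powr (k - 1) * exp (\<gamma> * lam * z - 1 / 2 * z powr k))
        \<le> C * (k / lam) * (K * exp (- z))"
      using K(2)[of z] z C lam_pos k_gt_1 by (intro mult_left_mono) auto
    finally show ?thesis using z by (simp add: s_def z_def mult.assoc)
  qed
  show ?thesis
    unfolding arg
  proof (rule ext_integral_less_infinity_if_exp_bound[OF lam_pos, where K = "C * (k / lam) * K"])
    show "0 \<le> C * (k / lam) * K" using C K lam_pos k_gt_1 by simp
  qed (use bound in \<open>auto simp: weibull_density_def zero_ereal_def\<close>)
qed

section \<open>Finiteness of the divergence\<close>

lemma exp_le_affine_exp_powr:
  obtains M where "0 \<le> M"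
    "\<And>r w. 0 \<le> r \<Longrightarrow> M + r \<le> a * w powr k \<Longrightarrow> exp r \<le> c1 * exp (a * w powr k) + c2"
proof
  \<comment> \<open>\<open>A\<close> absorbs both the factor \<open>c1\<close> and a possibly
    negative \<open>c2\<close>; its logarithm becomes an additive cost in the exponent, made
    nonnegative by the absolute value.\<close>
  define A where "A = (1 + \<bar>c2\<bar>) / c1"
  have A: "0 < A" using c1_pos by (simp add: A_def add_pos_nonneg)
  show "0 \<le> \<bar>ln A\<bar>" by simp
  fix r w :: real
  assume r: "0 \<le> r" and le: "\<bar>ln A\<bar> + r \<le> a * w powr k"
  have "exp r + \<bar>c2\<bar> * 1 \<le> exp r + \<bar>c2\<bar> * exp r"
    using r by (intro add_left_mono mult_left_mono) auto
  also have "\<dots> = c1 * (exp (ln A) * exp r)" using c1_pos A by (simp add: A_def field_simps)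
  also have "\<dots> = c1 * exp (ln A + r)" by (simp add: exp_add)
  also have "\<dots> \<le> c1 * exp (a * w powr k)" using le c1_pos by simp
  finally show "exp r \<le> c1 * exp (a * w powr k) + c2" by linarith
qed

lemma divergence_finite:
  assumes l: "1 < l" "l < k"
  shows "divergence (phi2 \<gamma> lam k) (weibull_density lam l) (weibull_density lam k) < \<infinity>"
proof -
  obtain M where M: "0 \<le> M"
    "\<And>r w. 0 \<le> r \<Longrightarrow> M + r \<le> a * w powr k \<Longrightarrow> exp r \<le> c1 * exp (a * w powr k) + c2"
    using exp_le_affine_exp_powr by blast
  \<comment> \<open>For \<open>z \<ge> 1\<close> one has
    \<open>M + z powr k \<le> (M + 1) * z powr k\<close>, and \<open>D\<close> makes this at most
    \<open>a * (D * z) powr k\<close>.\<close>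
  define D where "D = max 1 ((M + 1) / a)"
  \<comment> \<open>For \<open>z < 1\<close> the three entries serve \<open>1 \<le> w\<close>, the
    constant \<open>M\<close>, and the comparison of the coefficients of
    \<open>- ln z\<close>.\<close>
  define C where "C = Max {1, M / a, ((k - l) / (a * (l - 1))) powr (1 / (k - 1))}"
  have D: "1 \<le> D" "M + 1 \<le> a * D powr k"
  proof -
    show D1: "1 \<le> D" by (simp add: D_def)
    have "(M + 1) / a \<le> D" by (simp add: D_def)
    also have "D \<le> D powr k" using D1 k_gt_1 powr_mono[of 1 k D] by simp
    finally show "M + 1 \<le> a * D powr k" using a_pos by (simp add: field_simps)
  qed
  have C: "1 \<le> C" "M \<le> a * C powr k" "k - l \<le> a * C powr (k - 1) * (l - 1)"
  proof -
    show C1: "1 \<le> C" by (simp add: C_def)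
    have "M / a \<le> C" by (simp add: C_def)
    also have "C \<le> C powr k" using C1 k_gt_1 powr_mono[of 1 k C] by simp
    finally show "M \<le> a * C powr k" using a_pos by (simp add: field_simps)
    have "(k - l) / (a * (l - 1)) = (((k - l) / (a * (l - 1))) powr (1 / (k - 1))) powr (k - 1)"
      using l a_pos by (simp add: powr_powr)
    also have "\<dots> \<le> C powr (k - 1)"
      using k_gt_1 by (intro powr_mono2) (auto simp: C_def)
    finally show "k - l \<le> a * C powr (k - 1) * (l - 1)"
      using l a_pos by (simp add: field_simps)
  qed
  obtain K1 where K1: "0 \<le> K1" "\<And>z. 0 \<le> z \<Longrightarrow>
      z powr (l - 1) * exp (D * z - 1 * z powr l) \<le> K1 * exp (- z)"
    using powr_times_exp_bounded_by_exp_minus[of "l - 1" 1 l D] l by auto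
  obtain K2 where K2: "0 \<le> K2" "\<And>z. 0 \<le> z \<Longrightarrow>
      z powr (k - 1) * exp (0 * z - 1 * z powr k) \<le> K2 * exp (- z)"
    using powr_times_exp_bounded_by_exp_minus[of "k - 1" 1 k 0] k_gt_1 by auto
  \<comment> \<open>\<open>K1\<close> bounds \<open>g * exp w\<close> for \<open>z \<ge> 1\<close>
    and \<open>exp (C + 1)\<close> for \<open>z < 1\<close>; \<open>K2\<close> bounds the density
    \<open>h\<close> produced by the summand 1 in \<open>phi2_le\<close>.\<close>
  define K where "K = l / lam * (K1 + exp (C + 1)) + k / lam * K2"
  have bound: "phi2 \<gamma> lam k (weibull_density lam l x / weibull_density lam k x)
      * ereal (weibull_density lam k x) \<le> ereal (K * exp (- (\<bar>x\<bar> / lam)))" if "x < 0" for x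
  proof -
    define z where "z = \<bar>x\<bar> / lam"
    have z: "0 < z" using lam_pos that by (simp add: z_def divide_neg_pos)
    define g where "g = weibull_density lam l x"
    define h where "h = weibull_density lam k x"
    have g: "g = l / lam * z powr (l - 1) * exp (- (z powr l))"
      and h: "h = k / lam * z powr (k - 1) * exp (- (z powr k))"
      using that by (simp_all add: g_def h_def weibull_density_def z_def)
    have pos: "0 < g" "0 < h" using z l lam_pos k_gt_1 by (simp_all add: g h)
    define t where "t = g / h"
    have t: "t = l / k * exp (- (k - l) * ln z + (z powr k - z powr l))"
    proof -
      have "t = l / k * (z powr (l - 1) / z powr (k - 1)) * (exp (- (z powr l)) / exp (- (z powr k)))"
        using lam_pos by (simp add: t_def g h)
      also have "z powr (l - 1) / z powr (k - 1) = exp (- (k - l) * ln z)"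
        using z by (simp add: powr_def exp_diff[symmetric] algebra_simps)
      also have "exp (- (z powr l)) / exp (- (z powr k)) = exp (z powr k - z powr l)"
        by (simp add: exp_diff[symmetric])
      finally show ?thesis by (simp add: exp_add mult.assoc)
    qed
    \<comment> \<open>The prefactor \<open>l / k\<close> is below 1 and is dropped.\<close>
    have t_le: "t \<le> exp r" if "- (k - l) * ln z + (z powr k - z powr l) \<le> r" for r
    proof -
      have "t \<le> 1 * exp (- (k - l) * ln z + (z powr k - z powr l))"
        unfolding t using l by (intro mult_right_mono) auto
      also have "\<dots> \<le> exp r" using that by simp
      finally show ?thesis .
    qed
    have "\<exists>w\<ge>1. t \<le> c1 * exp (a * w powr k) + c2 \<and>
        g * exp w \<le> l / lam * (K1 + exp (C + 1)) * exp (- z)"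
    proof (cases "1 \<le> z")
      case True
      have zk: "1 \<le> z powr k" using True k_gt_1 by (simp add: ge_one_powr_ge_zero)
      have "M + z powr k \<le> (M + 1) * z powr k"
        using mult_left_mono[OF zk M(1)] by (simp add: algebra_simps)
      also have "\<dots> \<le> a * D powr k * z powr k" using D by (intro mult_right_mono) auto
      also have "\<dots> = a * (D * z) powr k" using D z by (simp add: powr_mult)
      finally have "exp (z powr k) \<le> c1 * exp (a * (D * z) powr k) + c2"
        by (intro M(2)) simp_all
      moreover have "t \<le> exp (z powr k)"
      proof (rule t_le)
        have "0 \<le> (k - l) * ln z" "0 \<le> z powr l" using True l by auto
        then show "- (k - l) * ln z + (z powr k - z powr l) \<le> z powr k"
          unfolding mult_minus_left by linarith
      qed
      moreover have "1 * 1 \<le> D * z" using True D by (intro mult_mono) auto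
      moreover have "g * exp (D * z) \<le> l / lam * (K1 + exp (C + 1)) * exp (- z)"
      proof -
        have "g * exp (D * z) = l / lam * (z powr (l - 1) * exp (D * z - 1 * z powr l))"
          by (simp add: g exp_diff exp_minus field_simps)
        also have "\<dots> \<le> l / lam * (K1 * exp (- z))"
          using K1(2)[of z] z l lam_pos by (intro mult_left_mono) auto
        also have "\<dots> \<le> l / lam * ((K1 + exp (C + 1)) * exp (- z))"
          using l lam_pos by (intro mult_left_mono mult_right_mono) auto
        finally show ?thesis by (simp add: mult.assoc)
      qed
      ultimately show ?thesis by (intro exI[of _ "D * z"]) auto
    next
      case False
      define w where "w = C - (l - 1) * ln z"
      have ln: "ln z \<le> 0" using False z by simp
      then have lnl: "(l - 1) * ln z \<le> 0" using l by (intro mult_nonneg_nonpos) auto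
      then have w: "C \<le> w" by (simp add: w_def)
      \<comment> \<open>Since \<open>C \<le> w\<close>, \<open>w powr k\<close> is at least
        \<open>C powr (k - 1) * w\<close>, which is affine in \<open>- ln z\<close>; the conditions
        on \<open>C\<close> compare constants and slopes.\<close>
      have "M + - (k - l) * ln z \<le> a * C powr k + a * C powr (k - 1) * (l - 1) * (- ln z)"
        using mult_right_mono[OF C(3), of "- ln z"] C(2) ln by (simp add: left_diff_distrib)
      also have "\<dots> = a * C powr (k - 1) * w"
        using C(1) by (simp add: w_def powr_diff field_simps)
      also have "\<dots> \<le> a * w powr (k - 1) * w"
        using w C(1) a_pos k_gt_1 by (intro mult_right_mono mult_left_mono powr_mono2) auto
      also have "\<dots> = a * w powr k" using w C(1) by (simp add: powr_diff)
      finally have "exp (- (k - l) * ln z) \<le> c1 * exp (a * w powr k) + c2"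
        using l ln by (intro M(2)) (auto intro: mult_nonpos_nonpos)
      moreover have "t \<le> exp (- (k - l) * ln z)"
      proof (rule t_le)
        have "z powr k \<le> z powr l" using False z l by (intro powr_mono') auto
        then show "- (k - l) * ln z + (z powr k - z powr l) \<le> - (k - l) * ln z" by simp
      qed
      moreover have "g * exp w \<le> l / lam * (K1 + exp (C + 1)) * exp (- z)"
      proof -
        have "exp w = exp C * z powr (- (l - 1))"
          using z by (simp add: w_def powr_def exp_add[symmetric] algebra_simps)
        then have "g * exp w = l / lam * (exp C * exp (- (z powr l)))"
          using z by (simp add: g powr_add[symmetric])
        \<comment> \<open>On the bounded range \<open>z < 1\<close> the decay
          \<open>exp (- z)\<close> costs only a factor \<open>exp 1\<close>, whence
          \<open>C + 1\<close> in \<open>K\<close>.\<close>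
        also have "\<dots> \<le> l / lam * (exp C * exp (1 - z))"
        proof -
          have "- (z powr l) \<le> 1 - z" using False powr_ge_zero[of z l] by linarith
          then show ?thesis using l lam_pos by (intro mult_left_mono) auto
        qed
        also have "\<dots> = l / lam * (exp (C + 1) * exp (- z))"
          by (simp add: exp_add[symmetric])
        also have "\<dots> \<le> l / lam * ((K1 + exp (C + 1)) * exp (- z))"
          using l lam_pos K1(1) by (intro mult_left_mono mult_right_mono) auto
        finally show ?thesis by (simp add: mult.assoc)
      qed
      ultimately show ?thesis using w C(1) by (intro exI[of _ w]) auto
    qed
    then obtain w where w: "1 \<le> w" "t \<le> c1 * exp (a * w powr k) + c2"
      "g * exp w \<le> l / lam * (K1 + exp (C + 1)) * exp (- z)" by blast
    have "0 \<le> t" using pos by (simp add: t_def)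
    then have "phi2 \<gamma> lam k t * ereal h \<le> ereal (t * exp w + 1) * ereal h"
      using w pos by (intro ereal_mult_right_mono phi2_le) auto
    also have "\<dots> = ereal (g * exp w + h)"
      using pos by (simp add: t_def field_simps)
    also have "\<dots> \<le> ereal (K * exp (- z))"
    proof -
      have "h = k / lam * (z powr (k - 1) * exp (0 * z - 1 * z powr k))" by (simp add: h)
      also have "\<dots> \<le> k / lam * (K2 * exp (- z))"
        using K2(2)[of z] z k_gt_1 lam_pos by (intro mult_left_mono) auto
      finally show ?thesis using w(3) by (simp add: K_def distrib_right mult.assoc)
    qed
    finally show ?thesis by (simp add: t_def g_def h_def z_def)
  qed
  show ?thesis
    unfolding divergence_def
  proof (rule ext_integral_less_infinity_if_exp_bound[OF lam_pos, where K = K])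
    show "0 \<le> K" using K1 K2 l lam_pos k_gt_1 by (simp add: K_def)
  next
    fix x :: real assume x: "x < 0"
    have "weibull_density lam l x \<noteq> 0" "weibull_density lam k x \<noteq> 0"
      using x l lam_pos k_gt_1 by (simp_all add: weibull_density_def)
    then show "divergence_integrand (phi2 \<gamma> lam k) (weibull_density lam l x) (weibull_density lam k x)
        \<le> ereal (K * exp (- (\<bar>x\<bar> / lam)))"
      using bound[OF x] by (simp add: divergence_integrand_def)
  next
    \<comment> \<open>Both densities vanish here, at \<open>x = 0\<close> because
      \<open>0 powr p = 0\<close>, so the convention for \<open>0 / 0\<close> applies.\<close>
    fix x :: real assume "0 \<le> x"
    then show "divergence_integrand (phi2 \<gamma> lam k) (weibull_density lam l x) (weibull_density lam k x) \<le> 0"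
      by (auto simp: divergence_integrand_def weibull_density_def)
  qed
qed

end

theorem lemma3:
  fixes \<gamma> lam k :: real
  assumes "\<gamma> > 0" and "lam > 0" and "k > 1"
  shows
    "(strictly_convex (phi2_star \<gamma> lam k) \<and>
      twice_continuously_differentiable (phi2_star \<gamma> lam k) \<and>
      phi2 \<gamma> lam k \<in> Phi0) \<and>
     ((\<exists>\<theta>1 \<theta>2 :: real.
         ext_integral lborel
           (\<lambda>x. ereal (phi2_star \<gamma> lam k (phi1_star \<gamma> (\<theta>2 - x) + \<theta>1))
                 * ereal (weibull_density lam k x)) < \<infinity>) \<and>
      (\<exists>\<theta>1 \<theta>2 \<eta> :: real. \<eta> \<ge> 0 \<and>
         ext_integral lborel
           (\<lambda>x. perspective (phi2_star \<gamma> lam k) \<eta> (phi1_star \<gamma> (\<theta>2 - x) + \<theta>1)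
                 * ereal (weibull_density lam k x)) < \<infinity>)) \<and>
     (\<forall>l :: real. 1 < l \<longrightarrow> l < k \<longrightarrow>
        divergence (phi2 \<gamma> lam k) (weibull_density lam l) (weibull_density lam k) < \<infinity>)"
proof -
  interpret weibull_entropic \<gamma> lam k
    by unfold_locales (use assms in auto)
  \<comment> \<open>With \<eta> = 1 the perspective is \<open>f\<close> itself, so the witnesses of
    the first integral serve again.\<close>
  have persp: "perspective f 1 s = ereal (f s)" for s
    by (simp add: perspective_def)
  have "\<exists>\<theta>1 \<theta>2 \<eta> :: real. \<eta> \<ge> 0 \<and>
      ext_integral lborel
        (\<lambda>x. perspective f \<eta> (phi1_star \<gamma> (\<theta>2 - x) + \<theta>1) * ereal (weibull_density lam k x)) < \<infinity>"
    by (rule exI[of _ "1 / \<gamma> - exp 1"], rule exI[of _ "ln \<gamma> / \<gamma>"], rule exI[of _ 1])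
      (use phi2_star_integral_finite in \<open>simp add: persp\<close>)
  then show ?thesis
    using f_strictly_convex f_twice_continuously_differentiable phi2_in_Phi0
      phi2_star_integral_finite divergence_finite by blast
qed

end
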